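(* Suppose $P_{n,K}$ is full-dimensional, and let $uv\in E$. The inequality $x_{u,v}\ge 0$ is facet-defining for $P_{n,K}$ if and only if $uv\notin\{12,13,23\}$.
   Context: $V=\{1,\dots,n\}$ and $E$ is the set of all unordered pairs $ij$ of distinct elements of $V$; $x_{i,j}=x_{j,i}$. A $K$-partition $\pi$ is a collection of $K$ non-empty pairwise disjoint subsets (clusters) of $V$ whose union is $V$. The representative of a cluster is its smallest element. The characteristic vector $x^\pi\in\{0,1\}^{|E|+|V|-3}$ of $\pi$ has components $x_4,\dots,x_n$ and $x_{i,j}$ for $ij\in E$, where $x^\pi_{i,j}=1$ if $i,j$ are in the same cluster and $0$ otherwise, and $x^\pi_u=1$ if $u$ is the representative of its cluster and $0$ otherwise. (Representative variables of vertices $1,2,3$ are not coordinates.) $P_{n,K}\subset\mathbb R^{|E|+|V|-3}$ is the convex hull of the characteristic vectors $x^\pi$ of all $K$-partitions $\pi$ of $V$ (equivalently, of all $0/1$ solutions of the integer formulation of the $K$-partitioning problem). It is full-dimensional (dimension $|E|+|V|-3$) if and only if $K\in\{3,\dots,n-2\}$. An inequality is facet-defining for $P_{n,K}$ if it is valid for $P_{n,K}$ and the set of points of $P_{n,K}$ satisfying it with equality has dimension $\dim(P_{n,K})-1$. *)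

theory Defs
  imports "HOL-Analysis.Analysis" "HOL-Library.Disjoint_Sets"
begin

definition edges :: "nat \<Rightarrow> nat set set" where
  "edges n = {{i, j} | i j. i \<in> {1..n} \<and> j \<in> {1..n} \<and> i \<noteq> j}"

text \<open>
  Names of the coordinates: \<open>Edge {i, j}\<close> names the component $x_{i,j}$ and \<open>Rep u\<close> the
  component $x_u$. Unordered pairs as sets make $x_{i,j} = x_{j,i}$ hold by construction.
\<close>
datatype coord = Edge "nat set" | Rep nat

definition coords :: "nat \<Rightarrow> coord set" where
  "coords n = Edge ` edges n \<union> Rep ` {4..n}"

text \<open>
  The ambient space is \<open>real ^ 'd\<close>, where a bijection \<open>idx\<close> from the index type \<open>'d\<close> onto
  \<open>coords n\<close> says which named coordinate each index stands for. Hence \<open>'d\<close> has exactly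
  $|E| + |V| - 3$ elements (for \<open>n \<ge> 3\<close>), see \<open>CARD_coord_indexing\<close>.
\<close>
definition coord_indexing :: "nat \<Rightarrow> ('d::finite \<Rightarrow> coord) \<Rightarrow> bool" where
  "coord_indexing n idx \<longleftrightarrow> bij_betw idx UNIV (coords n)"

definition k_partition :: "nat \<Rightarrow> nat \<Rightarrow> nat set set \<Rightarrow> bool" where
  "k_partition n K \<pi> \<longleftrightarrow> partition_on {1..n} \<pi> \<and> card \<pi> = K"

definition char_coord :: "nat set set \<Rightarrow> coord \<Rightarrow> real" where
  "char_coord \<pi> c = (case c of
      Edge e \<Rightarrow> of_bool (\<exists>C\<in>\<pi>. e \<subseteq> C)
    | Rep u \<Rightarrow> of_bool (\<exists>C\<in>\<pi>. u \<in> C \<and> u = Min C))"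

definition char_vec :: "('d::finite \<Rightarrow> coord) \<Rightarrow> nat set set \<Rightarrow> real ^ 'd" where
  "char_vec idx \<pi> = (\<chi> d. char_coord \<pi> (idx d))"

definition partition_polytope :: "('d::finite \<Rightarrow> coord) \<Rightarrow> nat \<Rightarrow> nat \<Rightarrow> (real ^ 'd) set" where
  "partition_polytope idx n K = convex hull {char_vec idx \<pi> | \<pi>. k_partition n K \<pi>}"

definition full_dimensional :: "'a::euclidean_space set \<Rightarrow> bool" where
  "full_dimensional S \<longleftrightarrow> aff_dim S = int DIM('a)"

text \<open>The inequality in question is \<open>a \<bullet> x \<ge> b\<close>.\<close>
definition facet_defining :: "'a::euclidean_space set \<Rightarrow> 'a \<Rightarrow> real \<Rightarrow> bool" where
  "facet_defining P a b \<longleftrightarrow>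
     (\<forall>x\<in>P. a \<bullet> x \<ge> b) \<and> aff_dim {x \<in> P. a \<bullet> x = b} = aff_dim P - 1"

text \<open>The unit vector \<open>a\<close> such that \<open>a \<bullet> x\<close> is the coordinate of \<open>x\<close> named \<open>c\<close>.\<close>
definition coord_axis :: "('d::finite \<Rightarrow> coord) \<Rightarrow> coord \<Rightarrow> real ^ 'd" where
  "coord_axis idx c = axis (inv idx c) 1"

lemma coord_axis_inner:
  assumes "coord_indexing n idx"
  shows "coord_axis idx (idx d) \<bullet> x = x $ d"
proof -
  have "inj idx" using assms by (simp add: coord_indexing_def bij_betw_def)
  then show ?thesis by (simp add: coord_axis_def inner_axis')
qed

lemma finite_edges: "finite (edges n)"
  by (rule finite_subset[of _ "Pow {1..n}"]) (auto simp: edges_def)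

lemma card_edges: "card (edges n) = n choose 2"
proof -
  have "edges n = {e. e \<subseteq> {1..n} \<and> card e = 2}"
    unfolding edges_def by (fastforce simp: card_2_iff)
  then show ?thesis using n_subsets[of "{1..n}" 2] by simp
qed

lemma CARD_coord_indexing:
  fixes idx :: "'d::finite \<Rightarrow> coord"
  assumes "coord_indexing n idx"
  shows "CARD('d) = card (edges n) + (n - 3)"
proof -
  have "CARD('d) = card (coords n)"
    using assms bij_betw_same_card unfolding coord_indexing_def by blast
  also have "\<dots> = card (Edge ` edges n) + card (Rep ` {4..n})"
    unfolding coords_def by (rule card_Un_disjoint) (auto simp: finite_edges)
  also have "\<dots> = card (edges n) + (n - 3)"
    by (simp add: card_image inj_on_def)
  finally show ?thesis .
qed

end

theory Submission
  imports Defs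
begin

text \<open>
  The number of representatives is \<open>K\<close>. If 1, 2, 3 are not all in one cluster, exactly
  $3 - x_{1,2} - x_{1,3} - x_{2,3}$ of them are representatives, so $x_{u,v} = 0$ with
  \<open>u, v \<le> 3\<close> forces the further equation
  $\sum_{w \ge 4} x_w - x_{1,2} - x_{1,3} - x_{2,3} = K - 3$, and the face has codimension at
  least 2. The same kind of equation rules out \<open>K \<le> 2\<close> and \<open>K \<ge> n - 1\<close>.

  Otherwise, let \<open>a \<bullet> x = b\<close> on all vertices of the face. Place \<open>p\<close> and \<open>q\<close> in the four possible
  ways into two clusters \<open>S\<close> and \<open>T\<close> of a partition of the remaining vertices into \<open>K\<close> clusters.
  In the alternating sum of the four equations every edge cancels except \<open>pq\<close>, which leaves
  $2 a_{p,q}$ plus representative terms. For \<open>p, q \<le> 3\<close> the latter are just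
  $a_{\min S} + a_{\min T}$ (with $a_1 = a_2 = a_3 = 0$); choosing the minima as \<open>{r, w}\<close> with
  \<open>r \<le> 3\<close>, and as \<open>{4, 5}\<close>, gives $a_w = 0$ for all \<open>w\<close>, and then every
  $a_{p,q}$ with \<open>pq \<noteq> uv\<close> vanishes.
\<close>

section \<open>Partitions as fibres of vertex labellings\<close>

text \<open>Working with labellings turns moving a vertex to another cluster into a function update,
  and the number of clusters into the number of labels used. Indexing the fibres by vertices keeps
  empty clusters out.\<close>

definition fibres :: "nat \<Rightarrow> (nat \<Rightarrow> nat) \<Rightarrow> nat set set" where
  "fibres n g = (\<lambda>i. {j \<in> {1..n}. g j = g i}) ` {1..n}"

definition is_rep :: "(nat \<Rightarrow> nat) \<Rightarrow> nat \<Rightarrow> bool" where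
  "is_rep g w \<longleftrightarrow> (\<forall>j\<in>{1..<w}. g j \<noteq> g w)"

lemma char_coord_fibres_edge:
  assumes "i \<in> {1..n}" "j \<in> {1..n}"
  shows "char_coord (fibres n g) (Edge {i, j}) = of_bool (g i = g j)"
proof -
  have "(\<exists>C\<in>fibres n g. {i, j} \<subseteq> C) \<longleftrightarrow> g i = g j"
  proof
    assume "\<exists>C\<in>fibres n g. {i, j} \<subseteq> C"
    then show "g i = g j" by (auto simp: fibres_def)
  next
    assume "g i = g j"
    then have "{i, j} \<subseteq> {k \<in> {1..n}. g k = g i}" using assms by simp
    then show "\<exists>C\<in>fibres n g. {i, j} \<subseteq> C"
      unfolding fibres_def using assms(1) by blast
  qed
  then show ?thesis by (simp add: char_coord_def)
qed

lemma char_coord_fibres_rep: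
  assumes "w \<in> {1..n}"
  shows "char_coord (fibres n g) (Rep w) = of_bool (is_rep g w)"
proof -
  have "(\<exists>C\<in>fibres n g. w \<in> C \<and> w = Min C) \<longleftrightarrow> w = Min {j \<in> {1..n}. g j = g w}"
    using assms by (auto simp: fibres_def)
  also have "\<dots> \<longleftrightarrow> (\<forall>j\<in>{j \<in> {1..n}. g j = g w}. w \<le> j)"
    using assms by (subst eq_commute, subst Min_eq_iff) auto
  also have "\<dots> \<longleftrightarrow> is_rep g w"
    using assms unfolding is_rep_def by (auto simp: not_less[symmetric])
  finally show ?thesis by (simp add: char_coord_def)
qed

lemma k_partition_fibres: "k_partition n (card (g ` {1..n})) (fibres n g)"
proof -
  have "fibres n g = (\<lambda>c. {j \<in> {1..n}. g j = c}) ` (g ` {1..n})"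
    by (auto simp: fibres_def)
  moreover have "inj_on (\<lambda>c. {j \<in> {1..n}. g j = c}) (g ` {1..n})"
    by (rule inj_onI) blast
  ultimately have "card (fibres n g) = card (g ` {1..n})"
    by (simp add: card_image)
  moreover have "partition_on {1..n} (fibres n g)"
    by (rule partition_onI) (auto simp: fibres_def disjnt_iff)
  ultimately show ?thesis by (simp add: k_partition_def)
qed

text \<open>Number the finitely many clusters injectively by \<open>h\<close> and label each vertex
  with the number of its cluster \<open>cl i\<close>.\<close>

lemma k_partition_imp_fibres:
  assumes "k_partition n K \<pi>"
  obtains g where "\<pi> = fibres n g" "card (g ` {1..n}) = K"
proof -
  have part: "partition_on {1..n} \<pi>" and card: "card \<pi> = K"
    using assms by (auto simp: k_partition_def)
  have fin: "finite \<pi>" using part finite_elements by blast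
  then obtain h :: "nat set \<Rightarrow> nat" where h: "inj_on h \<pi>"
    using finite_imp_inj_to_nat_seg by blast
  have ex: "\<exists>C\<in>\<pi>. i \<in> C" if "i \<in> {1..n}" for i
    using part that by (auto simp: partition_on_def)
  define cl where "cl i = (SOME C. C \<in> \<pi> \<and> i \<in> C)" for i
  have cl: "cl i \<in> \<pi>" "i \<in> cl i" if "i \<in> {1..n}" for i
    using someI_ex[of "\<lambda>C. C \<in> \<pi> \<and> i \<in> C"] ex[OF that] by (auto simp: cl_def)
  have cl_eq: "cl i = C" if "C \<in> \<pi>" "i \<in> C" for i C
  proof -
    have "i \<in> {1..n}" using part that by (auto simp: partition_on_def)
    then show ?thesis using cl that part unfolding partition_on_def disjoint_def by blast
  qed
  have eq: "{j \<in> {1..n}. h (cl j) = h (cl i)} = cl i" if "i \<in> {1..n}" for i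
  proof -
    have "h (cl j) = h (cl i) \<longleftrightarrow> j \<in> cl i" if "j \<in> {1..n}" for j
      using inj_onD[OF h] cl[OF that] cl[OF \<open>i \<in> {1..n}\<close>] cl_eq by metis
    moreover have "cl i \<subseteq> {1..n}" using part cl[OF that] by (auto simp: partition_on_def)
    ultimately show ?thesis by auto
  qed
  have img: "cl ` {1..n} = \<pi>"
  proof
    show "\<pi> \<subseteq> cl ` {1..n}"
    proof
      fix C assume C: "C \<in> \<pi>"
      then obtain i where "i \<in> C" using part by (metis partition_on_def ex_in_conv)
      then show "C \<in> cl ` {1..n}"
        using C cl_eq[of C i] part by (auto simp: partition_on_def)
    qed
  qed (use cl in auto)
  have "fibres n (\<lambda>i. h (cl i)) = cl ` {1..n}"
    unfolding fibres_def using eq by (intro image_cong) auto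
  moreover have "card ((\<lambda>i. h (cl i)) ` {1..n}) = K"
    using card_image[OF h] card img by (simp add: image_image[symmetric, of h cl])
  ultimately show ?thesis using that[of "\<lambda>i. h (cl i)"] img by simp
qed

text \<open>Distinct representatives carry distinct labels, and each label is attained by the least
  vertex carrying it.\<close>

lemma card_reps: "(\<Sum>w=1..n. of_bool (is_rep g w)) = (of_nat (card (g ` {1..n})) :: real)"
proof -
  define R where "R = {1..n} \<inter> {w. is_rep g w}"
  have "inj_on g R"
  proof (rule inj_onI)
    fix x y assume *: "x \<in> R" "y \<in> R" "g x = g y"
    show "x = y"
    proof (rule ccontr)
      assume "x \<noteq> y"
      then consider "x < y" | "y < x" by linarith
      then show False using * by cases (auto simp: R_def is_rep_def)
    qed
  qed
  moreover have "g ` R = g ` {1..n}"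
  proof
    show "g ` {1..n} \<subseteq> g ` R"
    proof
      fix c assume "c \<in> g ` {1..n}"
      then have ex: "\<exists>i. i \<in> {1..n} \<and> g i = c" by auto
      define m where "m = (LEAST i. i \<in> {1..n} \<and> g i = c)"
      have m: "m \<in> {1..n}" "g m = c" using LeastI_ex[OF ex] by (auto simp: m_def)
      have "is_rep g m" unfolding is_rep_def
      proof
        fix j assume j: "j \<in> {1..<m}"
        then have "\<not> (j \<in> {1..n} \<and> g j = c)"
          unfolding m_def using not_less_Least[of j "\<lambda>i. i \<in> {1..n} \<and> g i = c"] by simp
        then show "g j \<noteq> g m" using m j by auto
      qed
      then show "c \<in> g ` R" using m by (auto simp: R_def)
    qed
  qed (auto simp: R_def)
  ultimately have "card R = card (g ` {1..n})" using card_image by metis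
  then show ?thesis by (simp add: R_def)
qed

text \<open>Turns a coarse pattern \<open>f\<close> into one with exactly \<open>K\<close> clusters
  while keeping apart whatever \<open>f\<close> separates. While there are fewer labels than
  elements, two elements share a label, and one of them can receive a fresh one.\<close>

lemma refine_labelling:
  fixes f :: "'a \<Rightarrow> nat"
  assumes "finite X" "card (f ` X) \<le> K" "K \<le> card X"
  shows "\<exists>g :: 'a \<Rightarrow> nat. card (g ` X) = K \<and> (\<forall>x\<in>X. \<forall>y\<in>X. g x = g y \<longrightarrow> f x = f y)"
  using assms(2,3)
proof (induction K rule: dec_induct)
  case base
  then show ?case by blast
next
  case (step m)
  then obtain g :: "'a \<Rightarrow> nat" where g: "card (g ` X) = m"
    "\<forall>x\<in>X. \<forall>y\<in>X. g x = g y \<longrightarrow> f x = f y" by auto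
  have "\<not> inj_on g X" using card_image[of g X] g(1) step.hyps step.prems by linarith
  then obtain x y where xy: "x \<in> X" "y \<in> X" "x \<noteq> y" "g x = g y"
    by (auto simp: inj_on_def)
  obtain c where c: "c \<notin> g ` X"
    using ex_new_if_finite[of "g ` X"] assms(1) by auto
  \<comment> \<open>The old label of \<open>x\<close> survives at \<open>y\<close>, so exactly one
    label is added.\<close>
  have "g(x := c) ` X = insert c (g ` X)"
    using xy by (auto simp: image_iff)
  then have "card (g(x := c) ` X) = Suc m" using c g assms(1) by simp
  moreover have "\<forall>a\<in>X. \<forall>b\<in>X. (g(x := c)) a = (g(x := c)) b \<longrightarrow> f a = f b"
    using c g(2) by (metis fun_upd_apply imageI)
  ultimately show ?case by blast
qed

section \<open>Second differences of a linear functional\<close>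

lemma sum_coords:
  fixes idx :: "'d::finite \<Rightarrow> coord" and B :: "coord \<Rightarrow> real"
  assumes "coord_indexing n idx"
  shows "(\<Sum>d\<in>UNIV. B (idx d)) = (\<Sum>e\<in>edges n. B (Edge e)) + (\<Sum>w=4..n. B (Rep w))"
proof -
  have "(\<Sum>d\<in>UNIV. B (idx d)) = sum B (coords n)"
    using assms unfolding coord_indexing_def by (rule sum.reindex_bij_betw)
  also have "\<dots> = sum B (Edge ` edges n) + sum B (Rep ` {4..n})"
    unfolding coords_def by (rule sum.union_disjoint) (auto simp: finite_edges)
  finally show ?thesis by (simp add: sum.reindex inj_on_def)
qed

text \<open>The indicator of an edge other than \<open>{p, q}\<close> depends on at most one of the
  two placements, so it cancels in the alternating sum; for \<open>{p, q}\<close> itself the sum is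
  1 - 0 - 0 + 1 = 2. Cluster minima may depend on both placements, so their terms remain.\<close>

lemma second_difference:
  fixes a :: "real ^ 'd" and idx :: "'d::finite \<Rightarrow> coord"
  assumes idx: "coord_indexing n idx"
    and pq: "p \<in> {1..n}" "q \<in> {1..n}" "p \<noteq> q"
    and st: "s \<noteq> t"
    and eq: "\<And>x y. x \<in> {s, t} \<Longrightarrow> y \<in> {s, t} \<Longrightarrow>
      a \<bullet> char_vec idx (fibres n (g(p := x, q := y))) = b"
  shows "2 * a $ inv idx (Edge {p, q}) + (\<Sum>w=4..n. a $ inv idx (Rep w) *
    (of_bool (is_rep (g(p := s, q := s)) w) - of_bool (is_rep (g(p := s, q := t)) w)
     - of_bool (is_rep (g(p := t, q := s)) w) + of_bool (is_rep (g(p := t, q := t)) w))) = 0"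
proof -
  define h where "h x y = g(p := x, q := y)" for x y
  define D where "D c = char_coord (fibres n (h s s)) c - char_coord (fibres n (h s t)) c
    - char_coord (fibres n (h t s)) c + char_coord (fibres n (h t t)) c" for c
  have inj: "inj idx" using idx by (simp add: coord_indexing_def bij_betw_def)
  have D_edge: "D (Edge e) = (if e = {p, q} then 2 else 0)" if e: "e \<in> edges n" for e
  proof -
    obtain i j where ij: "e = {i, j}" "i \<in> {1..n}" "j \<in> {1..n}" "i \<noteq> j"
      using e unfolding edges_def by blast
    have val: "D (Edge e) = of_bool (h s s i = h s s j) - of_bool (h s t i = h s t j)
      - of_bool (h t s i = h t s j) + of_bool (h t t i = h t t j)"
      using ij by (simp add: D_def char_coord_fibres_edge)
    show ?thesis unfolding val
      using ij(4) pq(3) st by (auto simp: ij(1) h_def doubleton_eq_iff)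
  qed
  have "0 = a \<bullet> char_vec idx (fibres n (h s s)) - a \<bullet> char_vec idx (fibres n (h s t))
      - a \<bullet> char_vec idx (fibres n (h t s)) + a \<bullet> char_vec idx (fibres n (h t t))"
    using eq[of s s] eq[of s t] eq[of t s] eq[of t t] by (simp add: h_def)
  also have "\<dots> = (\<Sum>d\<in>UNIV. a $ d * D (idx d))"
    by (simp add: inner_vec_def char_vec_def D_def algebra_simps sum.distrib sum_subtractf)
  also have "\<dots> = (\<Sum>d\<in>UNIV. (\<lambda>c. a $ inv idx c * D c) (idx d))"
    using inj by simp
  also have "\<dots> = (\<Sum>e\<in>edges n. a $ inv idx (Edge e) * D (Edge e))
      + (\<Sum>w=4..n. a $ inv idx (Rep w) * D (Rep w))"
    by (rule sum_coords[OF idx])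
  also have "(\<Sum>e\<in>edges n. a $ inv idx (Edge e) * D (Edge e))
      = (\<Sum>e\<in>edges n. if e = {p, q} then 2 * a $ inv idx (Edge {p, q}) else 0)"
    by (rule sum.cong) (auto simp: D_edge)
  also have "\<dots> = 2 * a $ inv idx (Edge {p, q})"
    using pq by (subst sum.delta[OF finite_edges]) (auto simp: edges_def)
  also have "(\<Sum>w=4..n. a $ inv idx (Rep w) * D (Rep w)) = (\<Sum>w=4..n. a $ inv idx (Rep w) *
    (of_bool (is_rep (h s s) w) - of_bool (is_rep (h s t) w)
     - of_bool (is_rep (h t s) w) + of_bool (is_rep (h t t) w)))"
    by (rule sum.cong) (auto simp: D_def char_coord_fibres_rep)
  finally show ?thesis by (simp add: h_def)
qed

section \<open>Affine dimension and the vertices of the polytope\<close>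

text \<open>The functionals constant on \<open>S\<close> form the orthogonal complement of the
  direction space of \<open>S\<close>. If they all lie on one line, that space has codimension at
  most 1.\<close>

lemma aff_dim_ge_hyperplane:
  fixes S :: "'a::euclidean_space set"
  assumes "S \<noteq> {}"
    and "\<And>y b. (\<And>x. x \<in> S \<Longrightarrow> y \<bullet> x = b) \<Longrightarrow> y \<in> span {e}"
  shows "aff_dim S \<ge> int DIM('a) - 1"
proof -
  obtain x0 where x0: "x0 \<in> S" using assms by auto
  define T where "T = (+) (- x0) ` S"
  have "{y \<in> UNIV. \<forall>x\<in>span T. orthogonal x y} \<subseteq> span {e}"
  proof
    fix y assume "y \<in> {y \<in> UNIV. \<forall>x\<in>span T. orthogonal x y}"
    then have "orthogonal (x - x0) y" if "x \<in> S" for x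
      using that by (auto simp: T_def intro!: span_base)
    then have "y \<bullet> x = y \<bullet> x0" if "x \<in> S" for x
      using that by (simp add: orthogonal_def inner_diff_right inner_commute)
    then show "y \<in> span {e}" using assms(2) by blast
  qed
  then have "dim {y \<in> UNIV. \<forall>x\<in>span T. orthogonal x y} \<le> dim {e}"
    using dim_subset dim_span by metis
  also have "\<dots> \<le> 1" using dim_le_card'[of "{e}"] by simp
  finally have "dim {y \<in> UNIV. \<forall>x\<in>span T. orthogonal x y} \<le> 1" .
  moreover have "dim {y \<in> UNIV. \<forall>x\<in>span T. orthogonal x y} + dim (span T) = DIM('a)"
    using dim_subspace_orthogonal_to_vectors[of "span T" UNIV] by (simp add: subspace_span)
  moreover have "aff_dim S = int (dim T)"
    unfolding T_def using x0 by (intro aff_dim_eq_dim) (auto intro: hull_inc)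
  ultimately show ?thesis by (simp only: dim_span)
qed

lemma edge_iff: "{i, j} \<in> edges n \<longleftrightarrow> i \<in> {1..n} \<and> j \<in> {1..n} \<and> i \<noteq> j"
  unfolding edges_def by (auto simp: doubleton_eq_iff)

lemma partition_polytope_fibres:
  "partition_polytope idx n K =
    convex hull ((\<lambda>g. char_vec idx (fibres n g)) ` {g. card (g ` {1..n}) = K})"
proof -
  have "{char_vec idx \<pi> | \<pi>. k_partition n K \<pi>} =
      (\<lambda>g. char_vec idx (fibres n g)) ` {g. card (g ` {1..n}) = K}"
  proof (intro equalityI subsetI)
    fix x assume "x \<in> {char_vec idx \<pi> | \<pi>. k_partition n K \<pi>}"
    then obtain \<pi> where "x = char_vec idx \<pi>" "k_partition n K \<pi>" by blast
    then show "x \<in> (\<lambda>g. char_vec idx (fibres n g)) ` {g. card (g ` {1..n}) = K}"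
      by (auto elim!: k_partition_imp_fibres)
  next
    fix x assume "x \<in> (\<lambda>g. char_vec idx (fibres n g)) ` {g. card (g ` {1..n}) = K}"
    then obtain g where "x = char_vec idx (fibres n g)" "card (g ` {1..n}) = K" by blast
    then show "x \<in> {char_vec idx \<pi> | \<pi>. k_partition n K \<pi>}"
      using k_partition_fibres[of n g] by blast
  qed
  then show ?thesis by (simp add: partition_polytope_def)
qed

lemma partition_polytope_inner_ge:
  assumes "\<And>g. card (g ` {1..n}) = K \<Longrightarrow> b \<le> a \<bullet> char_vec idx (fibres n g)"
    and "x \<in> partition_polytope idx n K"
  shows "b \<le> a \<bullet> x"
proof -
  have "partition_polytope idx n K \<subseteq> {x. a \<bullet> x \<ge> b}"
    unfolding partition_polytope_fibres
    by (rule hull_minimal) (use assms(1) in \<open>auto simp: convex_halfspace_ge\<close>)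
  then show ?thesis using assms(2) by auto
qed

text \<open>A non-zero \<open>a\<close> would confine the vertices, hence their convex hull, to a
  hyperplane.\<close>

lemma full_dimensional_imp_zero:
  fixes a :: "real ^ 'd"
  assumes "full_dimensional (partition_polytope idx n K)"
    and "\<And>g. card (g ` {1..n}) = K \<Longrightarrow> a \<bullet> char_vec idx (fibres n g) = b"
  shows "a = 0"
proof (rule ccontr)
  assume "a \<noteq> 0"
  have "partition_polytope idx n K \<subseteq> {x. a \<bullet> x = b}"
    unfolding partition_polytope_fibres
    by (rule hull_minimal) (use assms(2) in \<open>auto simp: convex_hyperplane\<close>)
  then have "aff_dim (partition_polytope idx n K) \<le> aff_dim {x. a \<bullet> x = b}"
    by (rule aff_dim_subset)
  then show False
    using assms(1) \<open>a \<noteq> 0\<close> by (simp add: full_dimensional_def aff_dim_hyperplane)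
qed

section \<open>Edge coordinates and the count of representatives\<close>

lemma idx_inv:
  assumes "coord_indexing n idx" "c \<in> coords n"
  shows "idx (inv idx c) = c"
  using assms by (simp add: coord_indexing_def bij_betw_def f_inv_into_f)

lemma coord_axis_inner_edge:
  assumes "coord_indexing n idx" "{i, j} \<in> edges n"
  shows "coord_axis idx (Edge {i, j}) \<bullet> char_vec idx (fibres n g) = of_bool (g i = g j)"
proof -
  have c: "Edge {i, j} \<in> coords n" using assms(2) by (simp add: coords_def)
  have "i \<in> {1..n}" "j \<in> {1..n}" using assms(2) by (auto simp: edge_iff)
  then show ?thesis
    using coord_axis_inner[OF assms(1), of "inv idx (Edge {i, j})"] idx_inv[OF assms(1) c]
    by (simp add: char_vec_def char_coord_fibres_edge del: atLeastAtMost_iff)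
qed

text \<open>
  With $\sigma = x_{1,2} + x_{1,3} + x_{2,3} \in \{0, 1, 3\}$, the number of representatives among
  1, 2, 3 is $3 - \sigma$ unless $\sigma = 3$, and $(5 - \sigma) / 2$ unless $\sigma = 0$;
  hence the weights \<open>l = 1\<close> and \<open>l = 1/2\<close> used below.
\<close>

definition rep_triangle :: "real \<Rightarrow> ('d::finite \<Rightarrow> coord) \<Rightarrow> real ^ 'd" where
  "rep_triangle l idx = (\<chi> d. case idx d of
      Edge e \<Rightarrow> if e \<in> {{1, 2}, {1, 3}, {2, 3}} then - l else 0
    | Rep w \<Rightarrow> 1)"

lemma rep_triangle_inner:
  assumes idx: "coord_indexing n idx" and n: "n \<ge> 3"
  shows "rep_triangle l idx \<bullet> char_vec idx (fibres n g) =
    real (card (g ` {1..n})) - 1 - of_bool (g 1 \<noteq> g 2) - of_bool (g 1 \<noteq> g 3 \<and> g 2 \<noteq> g 3)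
    - l * (of_bool (g 1 = g 2) + of_bool (g 1 = g 3) + of_bool (g 2 = g 3))"
proof -
  define T :: "nat set set" where "T = {{1, 2}, {1, 3}, {2, 3}}"
  define B where "B c = (case c of Edge e \<Rightarrow> if e \<in> T then - l else 0 | Rep w \<Rightarrow> 1)
    * char_coord (fibres n g) c" for c
  have "T \<subseteq> edges n" using n by (auto simp: T_def edge_iff)
  have T_dist: "{1, 2::nat} \<noteq> {1, 3}" "{1, 2::nat} \<noteq> {2, 3}" "{1, 3::nat} \<noteq> {2, 3}"
    by (auto simp: doubleton_eq_iff)
  have "rep_triangle l idx \<bullet> char_vec idx (fibres n g) = (\<Sum>d\<in>UNIV. B (idx d))"
    unfolding inner_vec_def rep_triangle_def char_vec_def B_def T_def by simp
  also have "\<dots> = (\<Sum>e\<in>edges n. B (Edge e)) + (\<Sum>w=4..n. B (Rep w))"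
    by (rule sum_coords[OF idx])
  also have "(\<Sum>e\<in>edges n. B (Edge e)) = (\<Sum>e\<in>T. B (Edge e))"
    using \<open>T \<subseteq> edges n\<close> by (intro sum.mono_neutral_right) (auto simp: finite_edges B_def)
  also have "\<dots> = - l * (\<Sum>e\<in>T. char_coord (fibres n g) (Edge e))"
    by (simp add: B_def sum_distrib_left)
  also have "(\<Sum>e\<in>T. char_coord (fibres n g) (Edge e)) =
      of_bool (g 1 = g 2) + of_bool (g 1 = g 3) + of_bool (g 2 = g 3)"
    using T_dist n by (simp add: T_def char_coord_fibres_edge)
  also have "(\<Sum>w=4..n. B (Rep w)) = (\<Sum>w=4..n. of_bool (is_rep g w))"
    by (rule sum.cong) (auto simp: B_def char_coord_fibres_rep)
  also have "(\<Sum>w=4..n. of_bool (is_rep g w)) =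
      real (card (g ` {1..n})) - 1 - of_bool (g 1 \<noteq> g 2) - of_bool (g 1 \<noteq> g 3 \<and> g 2 \<noteq> g 3)"
  proof -
    have "{1..n} = {1, 2, 3} \<union> {4..n}" using n by auto
    then have "(\<Sum>w=1..n. of_bool (is_rep g w)) =
        (\<Sum>w\<in>{1, 2, 3}. of_bool (is_rep g w)) + (\<Sum>w=4..n. of_bool (is_rep g w) :: real)"
      by (simp only:) (rule sum.union_disjoint, auto)
    moreover have "{1..<2} = {1::nat}" "{1..<3} = {1, 2::nat}" by auto
    then have "is_rep g 1" "is_rep g 2 \<longleftrightarrow> g 1 \<noteq> g 2" "is_rep g 3 \<longleftrightarrow> g 1 \<noteq> g 3 \<and> g 2 \<noteq> g 3"
      by (auto simp: is_rep_def)
    then have "(\<Sum>w\<in>{1, 2, 3}. of_bool (is_rep g w)) =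
        (1 + of_bool (g 1 \<noteq> g 2) + of_bool (g 1 \<noteq> g 3 \<and> g 2 \<noteq> g 3) :: real)"
      by (simp del: sum_of_bool_eq)
    ultimately show ?thesis using card_reps[of g n] by linarith
  qed
  finally show ?thesis by simp
qed

section \<open>Equations that exclude full dimension or a facet\<close>

text \<open>Each excluded case has a non-zero functional that is constant on all vertices. For
  \<open>K\<close> at most 2, two of 1, 2, 3 share a cluster, so \<sigma> is not 0; for
  \<open>K\<close> at least n - 1 they cannot all be together, so \<sigma> is not 3.\<close>

lemma full_dimensional_imp_bounds:
  fixes idx :: "'d::finite \<Rightarrow> coord"
  assumes idx: "coord_indexing n idx"
    and full: "full_dimensional (partition_polytope idx n K)" and n: "n \<ge> 2"
  shows "3 \<le> K" "K + 2 \<le> n"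
proof -
  have e12: "{1, 2} \<in> edges n" using n by (auto simp: edge_iff)
  have n3: "n \<ge> 3"
  proof (rule ccontr)
    assume "\<not> n \<ge> 3"
    then have V: "{1..n} = {1, 2}" using n by auto
    have "coord_axis idx (Edge {1, 2}) = 0"
    proof (rule full_dimensional_imp_zero[OF full])
      fix g :: "nat \<Rightarrow> nat" assume "card (g ` {1..n}) = K"
      \<comment> \<open>With only two vertices, the edge value is 1 for one cluster and 0 for
        two.\<close>
      then show "coord_axis idx (Edge {1, 2}) \<bullet> char_vec idx (fibres n g) = 2 - real K"
        unfolding coord_axis_inner_edge[OF idx e12] V by (auto simp: card_insert_if)
    qed
    then show False by (simp add: coord_axis_def axis_eq_0_iff)
  qed
  have nonzero: "rep_triangle l idx \<noteq> 0" if "l \<noteq> 0" for l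
  proof
    have "idx (inv idx (Edge {1, 2})) = Edge {1, 2}"
      using idx e12 by (intro idx_inv) (auto simp: coords_def)
    then have "rep_triangle l idx $ inv idx (Edge {1, 2}) = - l"
      by (simp add: rep_triangle_def)
    moreover assume "rep_triangle l idx = 0"
    ultimately show False using that by simp
  qed
  show "3 \<le> K"
  proof (rule ccontr)
    assume K: "\<not> 3 \<le> K"
    have "rep_triangle (1/2) idx = 0"
    proof (rule full_dimensional_imp_zero[OF full])
      fix g :: "nat \<Rightarrow> nat" assume g: "card (g ` {1..n}) = K"
      have "card {g 1, g 2, g 3} \<le> card (g ` {1..n})"
        using n3 by (intro card_mono) auto
      then have "g 1 = g 2 \<or> g 1 = g 3 \<or> g 2 = g 3"
        using K g by (auto simp: card_insert_if split: if_splits)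
      \<comment> \<open>As \<sigma> is not 0, the value is K - (5 - \<sigma>)/2 -
        \<sigma>/2.\<close>
      then show "rep_triangle (1/2) idx \<bullet> char_vec idx (fibres n g) = real K - 5/2"
        unfolding rep_triangle_inner[OF idx n3] g by auto
    qed
    then show False using nonzero[of "1/2"] by simp
  qed
  show "K + 2 \<le> n"
  proof (rule ccontr)
    assume K: "\<not> K + 2 \<le> n"
    have "rep_triangle 1 idx = 0"
    proof (rule full_dimensional_imp_zero[OF full])
      fix g :: "nat \<Rightarrow> nat" assume g: "card (g ` {1..n}) = K"
      have "\<not> (g 1 = g 2 \<and> g 1 = g 3)"
      proof
        assume *: "g 1 = g 2 \<and> g 1 = g 3"
        \<comment> \<open>The labels of 2 and 3 already occur at 1, so at most n - 2 labels are
          used.\<close>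
        have "g ` {1..n} \<subseteq> g ` ({1..n} - {2, 3})"
        proof
          fix c assume "c \<in> g ` {1..n}"
          then obtain i where "i \<in> {1..n}" "c = g i" by auto
          moreover have "1 \<in> {1..n} - {2, 3}" using n3 by auto
          ultimately show "c \<in> g ` ({1..n} - {2, 3})"
            using * by (metis DiffI imageI insertE singletonD)
        qed
        then have "K \<le> card (g ` ({1..n} - {2, 3}))"
          unfolding g[symmetric] by (intro card_mono) auto
        also have "\<dots> \<le> card ({1..n} - {2, 3})" by (rule card_image_le) simp
        also have "\<dots> = n - 2" using n3 by (subst card_Diff_subset) auto
        finally show False using K n3 by simp
      qed
      then show "rep_triangle 1 idx \<bullet> char_vec idx (fibres n g) = real K - 3"
        unfolding rep_triangle_inner[OF idx n3] g by auto
    qed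
    then show False using nonzero[of 1] by simp
  qed
qed

text \<open>On vertices \<open>f\<close> equals K - 3, except for K - 4 when 1, 2, 3 share a
  cluster, and then x_{u,v} = 1. Hence K - 3 - x_{u,v} \<le> f \<bullet> x \<le> K - 3 on
  \<open>P\<close>, which puts the face into a second hyperplane.\<close>

lemma not_facet_defining_triangle:
  fixes idx :: "'d::finite \<Rightarrow> coord"
  assumes idx: "coord_indexing n idx"
    and full: "full_dimensional (partition_polytope idx n K)"
    and n: "n \<ge> 4" and uv: "{u, v} \<in> {{1, 2}, {1, 3}, {2, 3}}"
  shows "\<not> facet_defining (partition_polytope idx n K) (coord_axis idx (Edge {u, v})) 0"
proof
  define P where "P = partition_polytope idx n K"
  define e where "e = coord_axis idx (Edge {u, v})"
  define f where "f = rep_triangle 1 idx"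
  assume "facet_defining P e 0"
  then have dim: "aff_dim {x \<in> P. e \<bullet> x = 0} = int DIM(real ^ 'd) - 1"
    using full by (simp add: facet_defining_def full_dimensional_def P_def)
  have uv_edge: "{u, v} \<in> edges n" using uv n by (auto simp: edge_iff doubleton_eq_iff)
  have "e \<noteq> 0" by (simp add: e_def coord_axis_def axis_eq_0_iff)
  have n3: "n \<ge> 3" using n by simp
  have "u \<in> {1, 2, 3}" "v \<in> {1, 2, 3}" using uv by (elim insertE; force)+
  then have collapse: "g u = g v" if "g 1 = g 2" "g 1 = g 3" for g :: "nat \<Rightarrow> nat"
    using that by (elim insertE) simp_all
  have lower: "real K - 3 \<le> (f + e) \<bullet> x" if "x \<in> P" for x
  proof (rule partition_polytope_inner_ge[OF _ that[unfolded P_def]])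
    fix g :: "nat \<Rightarrow> nat" assume "card (g ` {1..n}) = K"
    then show "real K - 3 \<le> (f + e) \<bullet> char_vec idx (fibres n g)"
      using collapse[of g] unfolding f_def e_def inner_add_left rep_triangle_inner[OF idx n3]
        coord_axis_inner_edge[OF idx uv_edge] by auto
  qed
  have upper: "3 - real K \<le> (- f) \<bullet> x" if "x \<in> P" for x
  proof (rule partition_polytope_inner_ge[OF _ that[unfolded P_def]])
    fix g :: "nat \<Rightarrow> nat" assume "card (g ` {1..n}) = K"
    then show "3 - real K \<le> (- f) \<bullet> char_vec idx (fibres n g)"
      unfolding f_def inner_minus_left rep_triangle_inner[OF idx n3] by auto
  qed
  have sub: "{x \<in> P. e \<bullet> x = 0} \<subseteq> {x. f \<bullet> x = real K - 3}"
    using lower upper by (force simp: inner_add_left)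
  \<comment> \<open>A facet would span its whole hyperplane, so \<open>f\<close> would be constant
    there. The origin and the axis of \<open>Rep 4\<close> refute this: \<open>f\<close> is 0 at one
    and 1 at the other.\<close>
  have "affine hull {x \<in> P. e \<bullet> x = 0} = affine hull {x. e \<bullet> x = 0}"
    using dim \<open>e \<noteq> 0\<close>
    by (subst aff_dim_eq_full_gen[symmetric]) (auto simp: aff_dim_hyperplane)
  then have H: "{x. e \<bullet> x = 0} \<subseteq> {x. f \<bullet> x = real K - 3}"
    using hull_minimal[OF sub, of affine] by (simp add: affine_hyperplane hull_same)
  have "axis (inv idx (Rep 4)) 1 \<in> {x. e \<bullet> x = 0}"
  proof -
    have "Rep 4 \<in> coords n" "Edge {u, v} \<in> coords n"
      using n uv_edge by (auto simp: coords_def)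
    then have "inv idx (Rep 4) \<noteq> inv idx (Edge {u, v})"
      using idx_inv[OF idx] by (metis coord.distinct(1))
    then show ?thesis by (simp add: e_def coord_axis_def inner_axis_axis)
  qed
  then have "f \<bullet> axis (inv idx (Rep 4)) 1 = real K - 3" using H by blast
  moreover have "f \<bullet> axis (inv idx (Rep 4)) 1 = 1"
  proof -
    have "Rep 4 \<in> coords n" using n by (auto simp: coords_def)
    then show ?thesis
      using idx_inv[OF idx] by (simp add: f_def rep_triangle_def inner_axis)
  qed
  moreover have "f \<bullet> 0 = real K - 3" using H inner_zero_right by blast
  ultimately show False by simp
qed

section \<open>Linear equations valid on the face\<close>

text \<open>A vertex \<open>w\<close> above \<open>p\<close> and \<open>q\<close> stops being a
  representative once either joins its cluster. If no other smaller vertex is there and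
  \<open>w\<close> has label \<open>x\<close> or \<open>y\<close>, only the placement of both in the
  other cluster contributes. With a third label the four terms cancel.\<close>

lemma second_difference_rep:
  assumes "p \<in> {1..<w}" "q \<in> {1..<w}" "p \<noteq> q" "x \<noteq> y"
  shows "of_bool (is_rep (g(p := x, q := x)) w) - of_bool (is_rep (g(p := x, q := y)) w)
     - of_bool (is_rep (g(p := y, q := x)) w) + of_bool (is_rep (g(p := y, q := y)) w)
    = (of_bool ((\<forall>j\<in>{1..<w} - {p, q}. g j \<noteq> g w) \<and> g w \<in> {x, y}) :: real)"
proof -
  have rep: "is_rep (g(p := c, q := d)) w \<longleftrightarrow>
      (\<forall>j\<in>{1..<w} - {p, q}. g j \<noteq> g w) \<and> g w \<noteq> d \<and> g w \<noteq> c" for c d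
  proof -
    have "{1..<w} = {p, q} \<union> ({1..<w} - {p, q})" using assms by auto
    then have "is_rep (g(p := c, q := d)) w \<longleftrightarrow>
      (\<forall>j\<in>{p, q}. (g(p := c, q := d)) j \<noteq> g w) \<and> (\<forall>j\<in>{1..<w} - {p, q}. g j \<noteq> g w)"
      unfolding is_rep_def using assms by (simp del: atLeastLessThan_iff) auto
    then show ?thesis using assms by auto
  qed
  show ?thesis unfolding rep using assms(4) by (cases "g w = x"; cases "g w = y") simp_all
qed

text \<open>An arbitrary equation satisfied by all vertices with x_{u,v} = 0. For
  \<open>u \<ge> 4\<close> the lemmas below make every coefficient of \<open>a\<close> vanish except
  that of \<open>{u, v}\<close>.\<close>

locale face_equation =
  fixes n K u v :: nat and idx :: "'d::finite \<Rightarrow> coord" and a :: "real ^ 'd" and b :: real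
  assumes idx: "coord_indexing n idx"
    and K: "3 \<le> K" "K + 2 \<le> n"
    and uv: "u \<in> {1..n}" "v \<in> {1..n}" "u \<noteq> v"
    and eq: "\<And>g. card (g ` {1..n}) = K \<Longrightarrow> g u \<noteq> g v \<Longrightarrow>
      a \<bullet> char_vec idx (fibres n g) = b"
begin

text \<open>The pattern \<open>f\<close> has at most 3 \<le> K classes, and n - 2 \<ge> K vertices
  remain, so it refines to exactly \<open>K\<close> labels. The hosts \<open>g s\<close> and
  \<open>g t\<close> are labels in use, so no placement changes the count. Under \<open>sep\<close>,
  at most one of \<open>u\<close>, \<open>v\<close> moves, and the other lies outside both
  hosts.\<close>

lemma move_two_vertices:
  fixes f :: "nat \<Rightarrow> nat"
  assumes pq: "p \<in> {1..n}" "q \<in> {1..n}" "p \<noteq> q"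
    and X: "X = {1..n} - {p, q}"
    and st: "s \<in> X" "t \<in> X" "f s \<noteq> f t" and f: "\<And>x. f x < 3"
    and sep: "u \<in> X \<Longrightarrow> v \<in> X \<Longrightarrow> f u \<noteq> f v"
      "u \<notin> X \<Longrightarrow> v \<in> X \<and> f v \<noteq> f s \<and> f v \<noteq> f t"
      "v \<notin> X \<Longrightarrow> u \<in> X \<and> f u \<noteq> f s \<and> f u \<noteq> f t"
  obtains g :: "nat \<Rightarrow> nat" where "\<And>x y. x \<in> X \<Longrightarrow> y \<in> X \<Longrightarrow> g x = g y \<Longrightarrow> f x = f y"
    and "2 * a $ inv idx (Edge {p, q}) + (\<Sum>w=4..n. a $ inv idx (Rep w) *
      (of_bool (is_rep (g(p := g s, q := g s)) w) - of_bool (is_rep (g(p := g s, q := g t)) w)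
     - of_bool (is_rep (g(p := g t, q := g s)) w) + of_bool (is_rep (g(p := g t, q := g t)) w))) = 0"
proof -
  have "card (f ` X) \<le> card {..<3::nat}" using f by (intro card_mono) auto
  then have "card (f ` X) \<le> K" using K by simp
  moreover have "card X = n - 2" using pq unfolding X by (subst card_Diff_subset) auto
  then have "K \<le> card X" using K by simp
  moreover have "finite X" by (simp add: X)
  ultimately obtain g :: "nat \<Rightarrow> nat" where g: "card (g ` X) = K"
    "\<forall>x\<in>X. \<forall>y\<in>X. g x = g y \<longrightarrow> f x = f y"
    using refine_labelling[of X f K] by blast
  have gst: "g s \<noteq> g t" using g(2) st by blast
  have "a \<bullet> char_vec idx (fibres n (g(p := x, q := y))) = b"
    if xy: "x \<in> {g s, g t}" "y \<in> {g s, g t}" for x y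
  proof (rule eq)
    let ?h = "g(p := x, q := y)"
    have "{1..n} = insert p (insert q X)" using pq by (auto simp: X)
    moreover have "?h ` X = g ` X" by (rule image_cong) (auto simp: X)
    moreover have "?h p = x" "?h q = y" using pq(3) by simp_all
    ultimately have "?h ` {1..n} = insert x (insert y (g ` X))" by (simp only: image_insert)
    also have "\<dots> = g ` X"
    proof -
      have "x \<in> g ` X" "y \<in> g ` X" using xy st(1,2) by blast+
      then show ?thesis by (simp add: insert_absorb)
    qed
    finally show "card (?h ` {1..n}) = K" using g(1) by simp
    have hX: "?h z = g z" if "z \<in> X" for z using that by (auto simp: X)
    have hnX: "?h z \<in> {g s, g t}" if "z \<in> {1..n}" "z \<notin> X" for z
      using that xy by (auto simp: X)
    have other: "g z \<notin> {g s, g t}" if "z \<in> X" "f z \<noteq> f s" "f z \<noteq> f t" for z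
      using that g(2) st(1,2) by blast
    show "?h u \<noteq> ?h v"
    proof (cases "u \<in> X"; cases "v \<in> X")
      assume "u \<in> X" "v \<in> X"
      then have "g u \<noteq> g v" using sep(1) g(2) by blast
      then show ?thesis using hX \<open>u \<in> X\<close> \<open>v \<in> X\<close> by simp
    next
      assume "u \<notin> X" "v \<in> X"
      then show ?thesis using sep(2) other[of v] hX[of v] hnX[OF uv(1)] by metis
    next
      assume "u \<in> X" "v \<notin> X"
      then show ?thesis using sep(3) other[of u] hX[of u] hnX[OF uv(2)] by metis
    next
      assume "u \<notin> X" "v \<notin> X"
      then show ?thesis using sep(2) by blast
    qed
  qed
  from second_difference[OF idx pq gst this] show ?thesis using that g(2) by blast
qed

text \<open>Every \<open>w \<ge> 4\<close> exceeds \<open>p\<close> and \<open>q\<close>, so it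
  contributes exactly when it is the minimum, within \<open>X\<close>, of a host cluster. Minimality
  of \<open>s\<close> and \<open>t\<close> in their classes of \<open>f\<close> passes to the finer
  classes of \<open>g\<close>, so these minima are \<open>s\<close> and \<open>t\<close>; those
  below 4 have no coordinate.\<close>

lemma move_two_of_123:
  assumes pq: "p \<in> {1, 2, 3}" "q \<in> {1, 2, 3}" "p \<noteq> q" "u \<notin> {p, q}" "v \<notin> {p, q}"
    and X: "X = {1..n} - {p, q}"
    and st: "s \<in> X" "t \<in> X" "f s \<noteq> f t" and f: "\<And>x. f x < (3::nat)"
    and sep: "f u \<noteq> f v"
    and min_s: "\<And>x. x \<in> X \<Longrightarrow> f x = f s \<Longrightarrow> s \<le> x"
    and min_t: "\<And>x. x \<in> X \<Longrightarrow> f x = f t \<Longrightarrow> t \<le> x"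
  shows "2 * a $ inv idx (Edge {p, q}) + (\<Sum>w\<in>{s, t} \<inter> {4..n}. a $ inv idx (Rep w)) = 0"
proof -
  have pq': "p \<in> {1..n}" "q \<in> {1..n}" using pq K by auto
  have "u \<in> X" "v \<in> X" using pq uv by (auto simp: X)
  then obtain g :: "nat \<Rightarrow> nat" where
    g: "\<And>x y. x \<in> X \<Longrightarrow> y \<in> X \<Longrightarrow> g x = g y \<Longrightarrow> f x = f y"
    and diff: "2 * a $ inv idx (Edge {p, q}) + (\<Sum>w=4..n. a $ inv idx (Rep w) *
      (of_bool (is_rep (g(p := g s, q := g s)) w) - of_bool (is_rep (g(p := g s, q := g t)) w)
     - of_bool (is_rep (g(p := g t, q := g s)) w) + of_bool (is_rep (g(p := g t, q := g t)) w))) = 0"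
    using move_two_vertices[OF pq'(1,2) pq(3) X st f] sep by blast
  have gst: "g s \<noteq> g t" using g st by blast
  have rep: "(\<forall>j\<in>{1..<w} - {p, q}. g j \<noteq> g w) \<and> g w \<in> {g s, g t} \<longleftrightarrow> w \<in> {s, t}"
    if "w \<in> {4..n}" for w
  proof -
    have wX: "w \<in> X" using that pq by (auto simp: X)
    have main: "(\<forall>j\<in>{1..<w} - {p, q}. g j \<noteq> g w) \<and> g w = g z \<longleftrightarrow> w = z"
      if z: "z \<in> X" "\<And>x. x \<in> X \<Longrightarrow> f x = f z \<Longrightarrow> z \<le> x" for z
    proof
      assume *: "(\<forall>j\<in>{1..<w} - {p, q}. g j \<noteq> g w) \<and> g w = g z"
      then have "z \<le> w" using g[OF wX z(1)] z(2)[OF wX] by blast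
      moreover have "\<not> z < w"
      proof
        assume "z < w"
        then have "z \<in> {1..<w} - {p, q}" using z(1) by (auto simp: X)
        then show False using * by metis
      qed
      ultimately show "w = z" by simp
    next
      assume "w = z"
      have "g j \<noteq> g w" if j: "j \<in> {1..<w} - {p, q}" for j
      proof
        assume "g j = g w"
        moreover have "j \<in> X" using j wX by (auto simp: X)
        ultimately have "z \<le> j" using g z \<open>w = z\<close> by blast
        then show False using j \<open>w = z\<close> by simp
      qed
      then show "(\<forall>j\<in>{1..<w} - {p, q}. g j \<noteq> g w) \<and> g w = g z" using \<open>w = z\<close> by blast
    qed
    show ?thesis using main[OF st(1) min_s] main[OF st(2) min_t] by blast
  qed
  have "2 * a $ inv idx (Edge {p, q})
      + (\<Sum>w=4..n. a $ inv idx (Rep w) * of_bool (w \<in> {s, t})) = 0"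
  proof -
    have "(\<Sum>w=4..n. a $ inv idx (Rep w) *
      (of_bool (is_rep (g(p := g s, q := g s)) w) - of_bool (is_rep (g(p := g s, q := g t)) w)
     - of_bool (is_rep (g(p := g t, q := g s)) w) + of_bool (is_rep (g(p := g t, q := g t)) w)))
     = (\<Sum>w=4..n. a $ inv idx (Rep w) * of_bool (w \<in> {s, t}))"
    proof (rule sum.cong[OF refl])
      fix w assume w: "w \<in> {4..n}"
      have "p \<in> {1..<w}" "q \<in> {1..<w}" using w pq by auto
      from second_difference_rep[OF this pq(3) gst, of g] rep[OF w]
      show "a $ inv idx (Rep w) *
      (of_bool (is_rep (g(p := g s, q := g s)) w) - of_bool (is_rep (g(p := g s, q := g t)) w)
     - of_bool (is_rep (g(p := g t, q := g s)) w) + of_bool (is_rep (g(p := g t, q := g t)) w))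
      = a $ inv idx (Rep w) * of_bool (w \<in> {s, t})" by simp
    qed
    then show ?thesis using diff by simp
  qed
  also have "(\<Sum>w=4..n. a $ inv idx (Rep w) * of_bool (w \<in> {s, t}))
      = (\<Sum>w\<in>{s, t} \<inter> {4..n}. a $ inv idx (Rep w))"
    by (rule sum.mono_neutral_cong_right) auto
  finally show ?thesis .
qed

text \<open>Moving \<open>p\<close> and \<open>q\<close>, with \<open>r\<close> the least remaining
  vertex, the host minima \<open>{r, w}\<close> give 2E + A w = 0 for every \<open>w\<close>. The
  minima \<open>{4, 5}\<close>, available since n \<ge> K + 2 \<ge> 5, give 2E + A 4 + A 5 = 0.
  Together they force E = 0.\<close>

lemma rep_coefficient_zero:
  assumes u: "u \<ge> 4" and w: "w \<in> {4..n}"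
  shows "a $ inv idx (Rep w) = 0"
proof -
  obtain p q r where pqr: "p \<in> {1, 2, 3}" "q \<in> {1, 2, 3}" "p \<noteq> q" "v \<notin> {p, q}"
    "r \<in> {1, 2, 3}" "r \<notin> {p, q}"
  proof -
    consider (1) "v = 1" | (2) "v = 2" | (3) "v \<notin> {1, 2}" by blast
    then show ?thesis
    proof cases
      case 1
      show ?thesis by (rule that[of 2 3 1]) (simp_all add: 1)
    next
      case 2
      show ?thesis by (rule that[of 1 3 2]) (simp_all add: 2)
    next
      case 3
      then show ?thesis by (intro that[of 1 2 3]) simp_all
    qed
  qed
  define X where "X = {1..n} - {p, q}"
  have upq: "u \<notin> {p, q}" using u pqr by auto
  have r: "r \<in> X" "r \<le> 3" "r \<noteq> u" using pqr K u by (auto simp: X_def)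
  have r_min: "r \<le> x" if "x \<in> X" for x
  proof (cases "x \<le> 3")
    case True
    then have "x \<in> {1, 2, 3}" using that by (auto simp: X_def)
    then show ?thesis using that pqr by (auto simp: X_def)
  qed (use r in simp)
  let ?A = "\<lambda>w. a $ inv idx (Rep w)" and ?E = "a $ inv idx (Edge {p, q})"
  have single: "2 * ?E + ?A w = 0" if w: "w \<in> {4..n}" for w
  proof -
    \<comment> \<open>The vertices \<open>w\<close> and \<open>u\<close> are singled out, so
      \<open>u\<close> and \<open>v\<close> are separated even if one of them is \<open>w\<close>;
      \<open>r\<close> lies in the remaining class and is its minimum.\<close>
    define f :: "nat \<Rightarrow> nat" where "f x = (if x = w then 0 else if x = u then 1 else 2)" for x
    have "w \<in> X" using w pqr by (auto simp: X_def)
    have "2 * ?E + (\<Sum>w\<in>{r, w} \<inter> {4..n}. ?A w) = 0"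
    proof (rule move_two_of_123[where f = f, OF pqr(1-3) upq pqr(4) X_def r(1) \<open>w \<in> X\<close>])
      show "f r \<noteq> f w" using r w by (simp add: f_def)
      show "f x < 3" for x by (simp add: f_def)
      show "f u \<noteq> f v" using uv(3) by (simp add: f_def)
      show "r \<le> x" if "x \<in> X" for x using that by (rule r_min)
      show "w \<le> x" if "f x = f w" for x using that by (simp add: f_def split: if_splits)
    qed
    moreover have "{r, w} \<inter> {4..n} = {w}" using r w by auto
    ultimately show ?thesis by simp
  qed
  define f :: "nat \<Rightarrow> nat"
    where "f x = (if x = 4 then 0 else if x = 5 then 1 else if x = u \<and> v \<noteq> 4 then 0 else 2)" for x
  \<comment> \<open>The exception for \<open>u\<close> separates it from \<open>v\<close> and keeps 4 minimal in its class.\<close>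
  have X45: "4 \<in> X" "5 \<in> X" using pqr K by (auto simp: X_def)
  have "2 * ?E + (\<Sum>w\<in>{4, 5} \<inter> {4..n}. ?A w) = 0"
  proof (rule move_two_of_123[where f = f, OF pqr(1-3) upq pqr(4) X_def X45])
    show "f 4 \<noteq> f 5" by (simp add: f_def)
    show "f x < 3" for x by (simp add: f_def)
    show "f u \<noteq> f v" using uv(3) by (simp add: f_def)
    show "4 \<le> x" if "f x = f 4" for x using that u by (simp add: f_def split: if_splits)
    show "5 \<le> x" if "f x = f 5" for x using that by (simp add: f_def split: if_splits)
  qed
  moreover have "{4, 5} \<inter> {4..n} = {4, 5}" using K by auto
  ultimately have "2 * ?E + (?A 4 + ?A 5) = 0" by simp
  then have "?E = 0" using single[of 4] single[of 5] K by simp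
  then show ?thesis using single[OF w] by simp
qed

text \<open>Without representative terms the second difference is just twice the edge coefficient,
  so it remains to find two host clusters that keep \<open>u\<close> and \<open>v\<close>
  apart.\<close>

lemma edge_coefficient_zero:
  assumes rep: "\<And>w. w \<in> {4..n} \<Longrightarrow> a $ inv idx (Rep w) = 0"
    and pq: "p \<in> {1..n}" "q \<in> {1..n}" "p \<noteq> q" "{p, q} \<noteq> {u, v}"
  shows "a $ inv idx (Edge {p, q}) = 0"
proof -
  define X where "X = {1..n} - {p, q}"
  obtain s t and f :: "nat \<Rightarrow> nat" where st: "s \<in> X" "t \<in> X" "f s \<noteq> f t" "\<And>x. f x < 3"
    and sep: "u \<in> X \<Longrightarrow> v \<in> X \<Longrightarrow> f u \<noteq> f v"
      "u \<notin> X \<Longrightarrow> v \<in> X \<and> f v \<noteq> f s \<and> f v \<noteq> f t"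
      "v \<notin> X \<Longrightarrow> u \<in> X \<and> f u \<noteq> f s \<and> f u \<noteq> f t"
  proof (cases "u \<in> X \<and> v \<in> X")
    case True
    then show ?thesis
      \<comment> \<open>If neither \<open>u\<close> nor \<open>v\<close> moves, their own clusters
        serve as hosts.\<close>
      using that[of u v "\<lambda>x. if x = u then 0 else 1"] uv(3) by auto
  next
    case False
    have "u \<in> X \<or> v \<in> X" using pq uv by (auto simp: X_def)
    then obtain z where z: "z = u \<and> u \<in> X \<and> v \<notin> X \<or> z = v \<and> v \<in> X \<and> u \<notin> X"
      using False by blast
    \<comment> \<open>Here \<open>z\<close> is the one of \<open>u\<close>, \<open>v\<close> that
      stays put. As n \<ge> 5, two vertices besides \<open>p\<close>, \<open>q\<close>,
      \<open>z\<close> exist; they become the hosts, and \<open>z\<close> goes to a third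
      class.\<close>
    have "card ({1..n} - {p, q, z}) \<ge> card {1..n} - card {p, q, z}"
      by (rule diff_card_le_card_Diff) simp
    moreover have "card {p, q, z} \<le> 3" by (simp add: card_insert_if)
    ultimately have "\<not> card ({1..n} - {p, q, z}) \<le> Suc 0" using K by simp
    then obtain s t where *: "s \<in> {1..n} - {p, q, z}" "t \<in> {1..n} - {p, q, z}" "s \<noteq> t"
      by (subst (asm) card_le_Suc0_iff_eq) blast+
    then have "s \<in> X" "t \<in> X" "z \<noteq> s" "z \<noteq> t" by (auto simp: X_def)
    then show ?thesis
      using that[of s t "\<lambda>x. if x = s then 0 else if x = t then 1 else 2"] \<open>s \<noteq> t\<close> z
      by auto
  qed
  show ?thesis
    using move_two_vertices[OF pq(1-3) X_def st sep] rep by auto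
qed

end

section \<open>The facets and the equivalence\<close>

text \<open>The vertices \<open>S\<close> with x_{u,v} = 0 already have the dimension of the
  hyperplane, since only multiples of \<open>e\<close> are constant on them; the hyperplane itself
  bounds the face from above.\<close>

lemma facet_defining_edge:
  fixes idx :: "'d::finite \<Rightarrow> coord"
  assumes idx: "coord_indexing n idx"
    and full: "full_dimensional (partition_polytope idx n K)"
    and K: "3 \<le> K" "K + 2 \<le> n"
    and uv: "{u, v} \<in> edges n" and u4: "u \<ge> 4"
  shows "facet_defining (partition_polytope idx n K) (coord_axis idx (Edge {u, v})) 0"
proof -
  define P where "P = partition_polytope idx n K"
  define e where "e = coord_axis idx (Edge {u, v})"
  define S where "S = (\<lambda>g. char_vec idx (fibres n g)) ` {g. card (g ` {1..n}) = K \<and> g u \<noteq> g v}"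
  have uv': "u \<in> {1..n}" "v \<in> {1..n}" "u \<noteq> v"
    using uv by (auto simp: edge_iff)
  have "e \<noteq> 0" by (simp add: e_def coord_axis_def axis_eq_0_iff)
  have valid: "0 \<le> e \<bullet> x" if "x \<in> P" for x
    using that unfolding P_def e_def
    by (rule partition_polytope_inner_ge[rotated]) (simp add: coord_axis_inner_edge[OF idx uv])
  have "S \<subseteq> P"
    unfolding S_def P_def partition_polytope_fibres by (rule subset_trans[OF _ hull_subset]) auto
  moreover have "e \<bullet> x = 0" if "x \<in> S" for x
    using that by (auto simp: S_def e_def coord_axis_inner_edge[OF idx uv])
  ultimately have "aff_dim S \<le> aff_dim {x \<in> P. e \<bullet> x = 0}"
    by (intro aff_dim_subset) auto
  moreover have "aff_dim S \<ge> int DIM(real ^ 'd) - 1"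
  proof (rule aff_dim_ge_hyperplane)
    \<comment> \<open>Splitting off \<open>u\<close> and refining to \<open>K\<close> labels yields
      a vertex of the face.\<close>
    define f :: "nat \<Rightarrow> nat" where "f x = (if x = u then 0 else 1)" for x
    have "card (f ` {1..n}) \<le> card {..<2::nat}" by (rule card_mono) (auto simp: f_def)
    then obtain g :: "nat \<Rightarrow> nat" where g: "card (g ` {1..n}) = K"
      "\<forall>x\<in>{1..n}. \<forall>y\<in>{1..n}. g x = g y \<longrightarrow> f x = f y"
      using refine_labelling[of "{1..n}" f K] K by auto
    moreover have "f u \<noteq> f v" using uv'(3) by (simp add: f_def)
    ultimately have "g u \<noteq> g v" using uv'(1,2) by blast
    with g(1) show "S \<noteq> {}" by (auto simp: S_def)
  next
    fix a b assume ab: "\<And>x. x \<in> S \<Longrightarrow> a \<bullet> x = b"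
    interpret face_equation n K u v idx a b
      using idx K uv' ab by unfold_locales (auto simp: S_def)
    have zero: "a $ inv idx c = 0" if c: "c \<in> coords n" "c \<noteq> Edge {u, v}" for c
    proof (cases c)
      case (Edge k)
      then obtain p q where pq: "k = {p, q}" "p \<in> {1..n}" "q \<in> {1..n}" "p \<noteq> q"
        using c(1) unfolding coords_def edges_def by blast
      then show ?thesis
        using edge_coefficient_zero[OF rep_coefficient_zero[OF u4] pq(2-4)] Edge c(2) by auto
    next
      case (Rep w)
      then show ?thesis using c(1) rep_coefficient_zero[OF u4] by (auto simp: coords_def)
    qed
    have "a = (a $ inv idx (Edge {u, v})) *\<^sub>R e"
    proof (rule vec_eq_iff[THEN iffD2, rule_format])
      fix d
      have inj: "inj idx" and "idx d \<in> coords n"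
        using idx by (auto simp: coord_indexing_def bij_betw_def)
      then have "a $ d = 0" if "idx d \<noteq> Edge {u, v}" using zero[of "idx d"] that by simp
      moreover have "d = inv idx (Edge {u, v})" if "idx d = Edge {u, v}"
        using inj that by (metis inv_f_f)
      ultimately show "a $ d = ((a $ inv idx (Edge {u, v})) *\<^sub>R e) $ d"
        by (cases "idx d = Edge {u, v}") (auto simp: e_def coord_axis_def axis_def)
    qed
    then show "a \<in> span {e}" by (metis span_base span_scale singletonI)
  qed
  moreover have "aff_dim {x \<in> P. e \<bullet> x = 0} \<le> aff_dim {x. e \<bullet> x = 0}"
    by (rule aff_dim_subset) auto
  ultimately have "aff_dim {x \<in> P. e \<bullet> x = 0} = aff_dim P - 1"
    using full \<open>e \<noteq> 0\<close> by (simp add: full_dimensional_def P_def aff_dim_hyperplane)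
  then show ?thesis using valid by (simp add: facet_defining_def P_def e_def)
qed

theorem theorem4p1:
  fixes n K u v :: nat and idx :: "'d::finite \<Rightarrow> coord"
  assumes "coord_indexing n idx"
    and "full_dimensional (partition_polytope idx n K)"
    and "{u, v} \<in> edges n"
  shows "facet_defining (partition_polytope idx n K) (coord_axis idx (Edge {u, v})) 0 \<longleftrightarrow>
    {u, v} \<notin> {{1, 2}, {1, 3}, {2, 3}}"
proof -
  have uv: "u \<in> {1..n}" "v \<in> {1..n}" "u \<noteq> v"
    using assms(3) by (auto simp: edge_iff)
  then have "n \<ge> 2" by auto
  note K = full_dimensional_imp_bounds[OF assms(1,2) this]
  show ?thesis
  proof (cases "{u, v} \<in> {{1, 2}, {1, 3}, {2, 3}}")
    case True
    then show ?thesis using not_facet_defining_triangle[OF assms(1,2) _ True] K by simp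
  next
    case False
    \<comment> \<open>Any pair of distinct vertices below 4 is an excluded edge. The facet lemma
      wants the large endpoint first, hence the swap in the second case.\<close>
    have "u \<ge> 4 \<or> v \<ge> 4"
    proof (rule ccontr)
      assume "\<not> (u \<ge> 4 \<or> v \<ge> 4)"
      then have "u \<in> {1, 2, 3}" "v \<in> {1, 2, 3}" using uv by auto
      then show False using False uv(3) by (auto simp: insert_commute)
    qed
    then have "facet_defining (partition_polytope idx n K) (coord_axis idx (Edge {u, v})) 0"
    proof
      assume "u \<ge> 4"
      then show ?thesis using facet_defining_edge[OF assms(1,2) K assms(3)] by simp
    next
      assume "v \<ge> 4"
      then show ?thesis
        using facet_defining_edge[OF assms(1,2) K, of v u] assms(3) by (simp add: insert_commute)
    qed
    then show ?thesis using False by simp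
  qed
qed

end
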